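(* Let $A\in\mathbb{R}^{n\times d}$ have singular values $\sigma_1\ge\dots\ge\sigma_d>0$, let $1\le k<d$ and $\Delta>0$, and assume that $A$ is $(k,\Delta)$-separated, i.e. $\sigma_k^2-\sigma_{k+1}^2\ge\Delta\sigma_1^2$. Let $0<\varepsilon<1$ and let $\tilde A\in\mathbb{R}^{n\times\ell}$ satisfy $$\|AA^T-\tilde A\tilde A^T\|\le\mu\sigma_1^2\quad\text{for }\mu=\varepsilon^2\Delta/16.$$ Then $$\sum_{i=1}^n|L^k(i)-\tilde L^k(i)|\le\varepsilon\sum_{i=1}^nL^k(i).$$
   Context: $\|\cdot\|$ is the operator norm. Let $A=U\Sigma V^T$ and $\tilde A=\tilde U\tilde\Sigma\tilde V^T$ be SVDs with singular values in non-increasing order, and let $U_k,\tilde U_k\in\mathbb{R}^{n\times k}$ consist of the top $k$ left singular vectors of $A$ and $\tilde A$. With $e_i$ the $i$-th standard basis vector of $\mathbb{R}^n$, the rank-$k$ leverage score of row $i$ and its estimate are $$L^k(i)=\|e_i^TU_k\|_2^2,\qquad \tilde L^k(i)=\|e_i^T\tilde U_k\|_2^2.$$ *)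

theory Defs
  imports Complex_Main "Jordan_Normal_Form.Matrix"
begin

definition vec_norm2 :: "real vec \<Rightarrow> real" where
  "vec_norm2 v = sqrt (v \<bullet> v)"

text \<open>The set over which the supremum is taken contains the zero vector and the
  values are bounded above, so this is a genuine supremum for every matrix
  (and \<open>0\<close> for a matrix without rows or columns).\<close>

definition op_norm :: "real mat \<Rightarrow> real" where
  "op_norm M = (SUP v \<in> {v \<in> carrier_vec (dim_col M). vec_norm2 v \<le> 1}. vec_norm2 (M *\<^sub>v v))"

text \<open>Square matrix with orthonormal columns. The library's \<open>orthogonal_mat\<close> only
  requires the columns to be pairwise orthogonal and nonzero.\<close>

definition orthonormal_mat :: "nat \<Rightarrow> real mat \<Rightarrow> bool" where
  "orthonormal_mat n U \<longleftrightarrow> U \<in> carrier_mat n n \<and> transpose_mat U * U = 1\<^sub>m n"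

text \<open>Full singular value decomposition \<open>A = U S V\<^sup>T\<close> with \<open>U\<close> and \<open>V\<close> square and \<open>S\<close>
  rectangular diagonal of the same shape as \<open>A\<close>; \<open>diagonal_mat\<close> admits rectangular matrices.\<close>

definition is_svd :: "real mat \<Rightarrow> real mat \<Rightarrow> real mat \<Rightarrow> real mat \<Rightarrow> bool" where
  "is_svd A U S V \<longleftrightarrow>
     orthonormal_mat (dim_row A) U \<and>
     orthonormal_mat (dim_col A) V \<and>
     S \<in> carrier_mat (dim_row A) (dim_col A) \<and> diagonal_mat S \<and>
     (\<forall>i < min (dim_row A) (dim_col A). 0 \<le> S $$ (i, i)) \<and>
     (\<forall>i j. i \<le> j \<and> j < min (dim_row A) (dim_col A) \<longrightarrow> S $$ (j, j) \<le> S $$ (i, i)) \<and>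
     A = U * S * transpose_mat V"

text \<open>Singular values read off the diagonal factor, numbered from \<open>1\<close> and continued by \<open>0\<close>
  beyond the diagonal, so that an \<open>n \<times> d\<close> matrix with \<open>n < d\<close> also has \<open>d\<close> singular values.
  Matrix entries are numbered from \<open>0\<close>.\<close>

definition sing_val :: "real mat \<Rightarrow> nat \<Rightarrow> real" where
  "sing_val S j =
     (if 1 \<le> j \<and> j \<le> min (dim_row S) (dim_col S) then S $$ (j - 1, j - 1) else 0)"

definition first_cols :: "real mat \<Rightarrow> nat \<Rightarrow> real mat" where
  "first_cols U k = mat_of_cols (dim_row U) (take k (cols U))"

text \<open>The row vector \<open>e\<^sub>i\<^sup>T U\<^sub>k\<close> is written as the column vector \<open>U\<^sub>k\<^sup>T e\<^sub>i\<close>;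
  rows are numbered from \<open>0\<close>.\<close>

definition leverage :: "real mat \<Rightarrow> nat \<Rightarrow> nat \<Rightarrow> real" where
  "leverage U k i =
     (vec_norm2 (transpose_mat (first_cols U k) *\<^sub>v unit_vec (dim_row U) i))\<^sup>2"

end

theory Submission
  imports Defs "HOL-Analysis.L2_Norm" "Jordan_Normal_Form.Determinant"
begin

text \<open>Let \<open>P\<close> and \<open>Q\<close> be the projections onto the top \<open>k\<close> left singular spaces of \<open>A\<close> and
  of its approximation \<open>B\<close>, so that the leverage scores are their diagonal entries, and put \<open>t = tr (P Q)\<close>.
  The spectral gap gives \<open>tr (A A\<^sup>T (P - Q)) \<ge> \<Delta> \<sigma>\<^sub>1\<^sup>2 (k - t)\<close>, while Ky Fan's principle for \<open>B\<close>
  bounds the left-hand side by \<open>tr ((A A\<^sup>T - B B\<^sup>T) (P - Q)) \<le> 2 k \<mu> \<sigma>\<^sub>1\<^sup>2\<close>; hence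
  \<open>k - t \<le> k \<epsilon>\<^sup>2 / 8\<close>. Since projections satisfy \<open>P\<^sub>i\<^sub>i = \<Sum>\<^sub>j P\<^sub>i\<^sub>j\<^sup>2\<close>, Cauchy--Schwarz bounds
  \<open>\<Sum>\<^sub>i \<bar>P\<^sub>i\<^sub>i - Q\<^sub>i\<^sub>i\<bar>\<close> by the product of the Frobenius norms of \<open>P - Q\<close> and \<open>P + Q\<close>, which is
  \<open>2 sqrt (k\<^sup>2 - t\<^sup>2) \<le> k \<epsilon>\<close>.\<close>

section \<open>Euclidean norm and operator norm\<close>

lemma vec_norm2_nonneg: "0 \<le> vec_norm2 v"
  by (auto simp: vec_norm2_def scalar_prod_def intro!: sum_nonneg)

lemma vec_norm2_power2: "(vec_norm2 v)\<^sup>2 = v \<bullet> v"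
  by (auto simp: vec_norm2_def scalar_prod_def intro!: sum_nonneg)

lemma vec_norm2_eq_L2_set: "vec_norm2 v = L2_set (($) v) {..<dim_vec v}"
  by (simp add: vec_norm2_def L2_set_def scalar_prod_def power2_eq_square lessThan_atLeast0)

lemma scalar_prod_le_vec_norm2:
  assumes "dim_vec v = dim_vec w"
  shows "\<bar>v \<bullet> w\<bar> \<le> vec_norm2 v * vec_norm2 w"
proof -
  have "\<bar>v \<bullet> w\<bar> \<le> (\<Sum>i<dim_vec w. \<bar>v $ i\<bar> * \<bar>w $ i\<bar>)"
    unfolding scalar_prod_def lessThan_atLeast0 by (rule order_trans[OF sum_abs]) (simp add: abs_mult)
  also have "\<dots> \<le> L2_set (($) v) {..<dim_vec w} * L2_set (($) w) {..<dim_vec w}"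
    by (rule L2_set_mult_ineq)
  finally show ?thesis using assms by (simp add: vec_norm2_eq_L2_set)
qed

text \<open>A real supremum is an upper bound only once the set is known to be bounded. By
  Cauchy--Schwarz on each row, the sum of the row norms of \<open>M\<close> is a bound.\<close>

lemma vec_norm2_mult_le_op_norm:
  assumes v: "v \<in> carrier_vec (dim_col M)" and "vec_norm2 v \<le> 1"
  shows "vec_norm2 (M *\<^sub>v v) \<le> op_norm M"
  unfolding op_norm_def
proof (rule cSUP_upper)
  show "v \<in> {v \<in> carrier_vec (dim_col M). vec_norm2 v \<le> 1}" using assms by simp
  show "bdd_above ((\<lambda>v. vec_norm2 (M *\<^sub>v v)) ` {v \<in> carrier_vec (dim_col M). vec_norm2 v \<le> 1})"
  proof (rule bdd_aboveI2)
    fix x assume "x \<in> {v \<in> carrier_vec (dim_col M). vec_norm2 v \<le> 1}"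
    hence x: "x \<in> carrier_vec (dim_col M)" "vec_norm2 x \<le> 1" by auto
    have entry: "\<bar>row M i \<bullet> x\<bar> \<le> vec_norm2 (row M i)" for i
    proof -
      have "\<bar>row M i \<bullet> x\<bar> \<le> vec_norm2 (row M i) * vec_norm2 x"
        using x by (intro scalar_prod_le_vec_norm2) auto
      also have "\<dots> \<le> vec_norm2 (row M i) * 1"
        using x vec_norm2_nonneg by (intro mult_left_mono) auto
      finally show ?thesis by simp
    qed
    have "vec_norm2 (M *\<^sub>v x) \<le> (\<Sum>i<dim_row M. \<bar>(M *\<^sub>v x) $ i\<bar>)"
      unfolding vec_norm2_eq_L2_set dim_mult_mat_vec by (rule L2_set_le_sum_abs)
    also have "\<dots> \<le> (\<Sum>i<dim_row M. vec_norm2 (row M i))"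
      using entry by (intro sum_mono) auto
    finally show "vec_norm2 (M *\<^sub>v x) \<le> (\<Sum>i<dim_row M. vec_norm2 (row M i))" .
  qed
qed

text \<open>Cauchy--Schwarz for unit vectors. This is the only way in which the operator norm of the
  perturbation enters the main proof.\<close>

lemma quadratic_form_le_op_norm:
  assumes M: "M \<in> carrier_mat n n" and v: "v \<in> carrier_vec n" and "v \<bullet> v = 1"
  shows "\<bar>v \<bullet> (M *\<^sub>v v)\<bar> \<le> op_norm M"
proof -
  have n1: "vec_norm2 v = 1" using assms by (simp add: vec_norm2_def)
  have "\<bar>v \<bullet> (M *\<^sub>v v)\<bar> \<le> vec_norm2 v * vec_norm2 (M *\<^sub>v v)"
    using M v by (intro scalar_prod_le_vec_norm2) auto
  also have "\<dots> \<le> op_norm M"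
    using vec_norm2_mult_le_op_norm[of v M] M v n1 by simp
  finally show ?thesis .
qed

section \<open>Orthonormal bases and singular value decompositions\<close>

lemma orthonormal_mat_col:
  assumes "orthonormal_mat n U" "a < n" "b < n"
  shows "col U a \<bullet> col U b = (if a = b then 1 else 0)"
proof -
  have U: "U \<in> carrier_mat n n" "transpose_mat U * U = 1\<^sub>m n"
    using assms by (auto simp: orthonormal_mat_def)
  have "(transpose_mat U * U) $$ (a, b) = col U a \<bullet> col U b" using assms U(1) by simp
  thus ?thesis using assms U(2) by simp
qed

text \<open>For square matrices the left inverse \<open>transpose_mat U\<close> is also a right
  inverse, so \<open>transpose_mat U\<close> preserves the inner product of \<open>x\<close> with
  itself.\<close>

lemma orthonormal_mat_parseval:
  assumes "orthonormal_mat n U" "x \<in> carrier_vec n"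
  shows "(\<Sum>a<n. (col U a \<bullet> x)\<^sup>2) = x \<bullet> x"
proof -
  have U: "U \<in> carrier_mat n n" "transpose_mat U * U = 1\<^sub>m n"
    using assms by (auto simp: orthonormal_mat_def)
  hence UU: "U * transpose_mat U = 1\<^sub>m n"
    by (intro mat_mult_left_right_inverse[of "transpose_mat U"]) auto
  have "(\<Sum>a<n. (col U a \<bullet> x)\<^sup>2) = (transpose_mat U *\<^sub>v x) \<bullet> (transpose_mat U *\<^sub>v x)"
    using U(1) by (simp add: scalar_prod_def[of "transpose_mat U *\<^sub>v x"] power2_eq_square lessThan_atLeast0)
  also have "\<dots> = x \<bullet> (U *\<^sub>v (transpose_mat U *\<^sub>v x))"
    using U(1) assms(2) transpose_vec_mult_scalar[of U n n "transpose_mat U *\<^sub>v x" x]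
    by (metis comm_scalar_prod mult_mat_vec_carrier transpose_carrier_mat)
  also have "U *\<^sub>v (transpose_mat U *\<^sub>v x) = (U * transpose_mat U) *\<^sub>v x"
    using U(1) assms(2) by simp
  finally show ?thesis using UU assms(2) by simp
qed

text \<open>The form is the squared norm of \<open>transpose_mat A *\<^sub>v x\<close>, and the
  isometry \<open>V\<close> drops out of that norm. It replaces matrix traces by sums of squared
  inner products with singular vectors.\<close>

lemma is_svd_quadratic_form:
  assumes svd: "is_svd A U S V" and A: "A \<in> carrier_mat n d" and x: "x \<in> carrier_vec n"
  shows "x \<bullet> ((A * transpose_mat A) *\<^sub>v x) = (\<Sum>a<n. (sing_val S (a + 1))\<^sup>2 * (col U a \<bullet> x)\<^sup>2)"
proof -
  have U: "U \<in> carrier_mat n n" and V: "V \<in> carrier_mat d d" "transpose_mat V * V = 1\<^sub>m d"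
    and S: "S \<in> carrier_mat n d" "diagonal_mat S" and AE: "A = U * S * transpose_mat V"
    using svd A by (auto simp: is_svd_def orthonormal_mat_def)
  define y where "y = transpose_mat U *\<^sub>v x"
  define z where "z = transpose_mat S *\<^sub>v y"
  have y: "y \<in> carrier_vec n" and y_nth: "\<And>a. a < n \<Longrightarrow> y $ a = col U a \<bullet> x"
    using U x by (auto simp: y_def)
  have z: "z \<in> carrier_vec d" unfolding z_def using S(1) y by auto
  have US: "U * S \<in> carrier_mat n d" and VT: "transpose_mat V \<in> carrier_mat d d"
    and ST: "transpose_mat S \<in> carrier_mat d n" and UT: "transpose_mat U \<in> carrier_mat n n"
    using U S V by auto
  have "transpose_mat A = V * (transpose_mat S * transpose_mat U)"
    by (simp only: AE transpose_mult[OF US VT] transpose_mult[OF U S(1)] transpose_transpose)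
  hence Ax: "transpose_mat A *\<^sub>v x = V *\<^sub>v z"
    unfolding z_def y_def
    by (simp only: assoc_mult_mat_vec[OF V(1) mult_carrier_mat[OF ST UT] x]
        assoc_mult_mat_vec[OF ST UT x])
  have AT: "transpose_mat A \<in> carrier_mat d n" using A by simp
  have Vz: "V *\<^sub>v z \<in> carrier_vec d" using V z by auto
  have "x \<bullet> ((A * transpose_mat A) *\<^sub>v x) = x \<bullet> (A *\<^sub>v (V *\<^sub>v z))"
    by (simp only: assoc_mult_mat_vec[OF A AT x] Ax)
  also have "\<dots> = (V *\<^sub>v z) \<bullet> (V *\<^sub>v z)"
    by (simp only: transpose_vec_mult_scalar[OF A Vz x, symmetric] Ax)
  also have "\<dots> = (transpose_mat V *\<^sub>v (V *\<^sub>v z)) \<bullet> z"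
    by (rule transpose_vec_mult_scalar[OF V(1) z Vz, symmetric])
  also have "transpose_mat V *\<^sub>v (V *\<^sub>v z) = z"
    by (simp only: assoc_mult_mat_vec[OF VT V(1) z, symmetric] V(2) one_mult_mat_vec[OF z])
  also have "z \<bullet> z = (\<Sum>j<d. (z $ j)\<^sup>2)"
    using z by (simp add: scalar_prod_def lessThan_atLeast0 power2_eq_square)
  also have "\<dots> = (\<Sum>j<d. if j < n then (sing_val S (j + 1))\<^sup>2 * (y $ j)\<^sup>2 else 0)"
  proof (intro sum.cong refl)
    fix j assume "j \<in> {..<d}"
    hence j: "j < d" by simp
    have "z $ j = (\<Sum>a<n. S $$ (a, j) * y $ a)"
      using S(1) y j by (simp add: z_def scalar_prod_def lessThan_atLeast0)
    \<comment> \<open>Column \<open>j\<close> of \<open>S\<close> has at most its diagonal entry,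
      and none at all if \<open>j \<ge> n\<close>.\<close>
    also have "\<dots> = (\<Sum>a<n. if a = j then S $$ (j, j) * y $ j else 0)"
      using S j unfolding diagonal_mat_def by (intro sum.cong) auto
    finally show "(z $ j)\<^sup>2 = (if j < n then (sing_val S (j + 1))\<^sup>2 * (y $ j)\<^sup>2 else 0)"
      using S(1) j by (simp add: sing_val_def power_mult_distrib)
  qed
  also have "\<dots> = (\<Sum>j<min n d. (sing_val S (j + 1))\<^sup>2 * (y $ j)\<^sup>2)"
    by (rule sum.mono_neutral_cong_right) auto
  \<comment> \<open>If \<open>n > d\<close>, the added terms vanish because \<open>sing_val\<close>
    is continued by 0.\<close>
  also have "\<dots> = (\<Sum>a<n. (sing_val S (a + 1))\<^sup>2 * (col U a \<bullet> x)\<^sup>2)"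
    using S(1) y_nth by (intro sum.mono_neutral_cong_left) (auto simp: sing_val_def)
  finally show ?thesis .
qed

lemma is_svd_sing_val_antimono:
  assumes "is_svd A U S V" "1 \<le> i" "i \<le> j"
  shows "(sing_val S j)\<^sup>2 \<le> (sing_val S i)\<^sup>2"
proof (cases "j \<le> min (dim_row S) (dim_col S)")
  case True
  have "dim_row S = dim_row A" "dim_col S = dim_col A" using assms by (auto simp: is_svd_def)
  moreover have "j - 1 < min (dim_row A) (dim_col A)" "i - 1 \<le> j - 1"
    using True calculation assms(2,3) by auto
  ultimately show ?thesis using True assms unfolding sing_val_def is_svd_def
    by (auto intro!: power_mono)
next
  case False
  thus ?thesis by (auto simp: sing_val_def)
qed

text \<open>Applied to the doubly stochastic matrix \<open>c\<close> of squared inner products of two orthonormal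
  bases; with \<open>g = h\<close> it is Ky Fan's principle.\<close>

lemma doubly_stochastic_gap:
  fixes c :: "nat \<Rightarrow> nat \<Rightarrow> real"
  assumes kn: "k < n" and c0: "\<And>a b. 0 \<le> c a b"
    and col1: "\<And>b. b < n \<Longrightarrow> (\<Sum>a<n. c a b) = 1"
    and row1: "\<And>a. a < n \<Longrightarrow> (\<Sum>b<n. c a b) = 1"
    and fge: "\<And>a. a < k \<Longrightarrow> g \<le> f a" and fle: "\<And>a. k \<le> a \<Longrightarrow> a < n \<Longrightarrow> f a \<le> h"
  shows "(g - h) * (real k - (\<Sum>a<k. \<Sum>b<k. c a b)) \<le> (\<Sum>a<k. f a) - (\<Sum>b<k. \<Sum>a<n. f a * c a b)"
proof -
  define C where "C a = (\<Sum>b<k. c a b)" for a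
  have C0: "0 \<le> C a" for a using c0 by (auto simp: C_def intro: sum_nonneg)
  have C1: "C a \<le> 1" if "a < n" for a
    unfolding C_def row1[OF that, symmetric] using kn c0 by (intro sum_mono2) auto
  have split: "(\<Sum>a<n. F a) = (\<Sum>a<k. F a) + (\<Sum>a\<in>{k..<n}. F a)" for F :: "nat \<Rightarrow> real"
    using kn by (simp add: lessThan_atLeast0 sum.atLeastLessThan_concat)
  have "(\<Sum>a<n. C a) = (\<Sum>b<k. \<Sum>a<n. c a b)" unfolding C_def by (rule sum.swap)
  also have "\<dots> = real k" using kn col1 by simp
  \<comment> \<open>The column sums give total mass \<open>k\<close>, so the mass missing from the
    first \<open>k\<close> rows is exactly the mass in the remaining ones. One quantity thus
    multiplies both \<open>g\<close> and \<open>h\<close>.\<close>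
  finally have tot: "(\<Sum>a\<in>{k..<n}. C a) = real k - (\<Sum>a<k. C a)" using split[of C] by simp
  have "(\<Sum>b<k. \<Sum>a<n. f a * c a b) = (\<Sum>a<n. f a * C a)"
    unfolding C_def sum_distrib_left by (rule sum.swap)
  hence eq: "(\<Sum>a<k. f a) - (\<Sum>b<k. \<Sum>a<n. f a * c a b)
      = (\<Sum>a<k. f a * (1 - C a)) - (\<Sum>a\<in>{k..<n}. f a * C a)"
    by (simp add: split sum_subtractf right_diff_distrib)
  have "(\<Sum>a<k. g * (1 - C a)) \<le> (\<Sum>a<k. f a * (1 - C a))"
    using fge C1 kn by (intro sum_mono mult_right_mono) auto
  hence 1: "g * (real k - (\<Sum>a<k. C a)) \<le> (\<Sum>a<k. f a * (1 - C a))"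
    by (simp add: sum_distrib_left[symmetric] sum_subtractf)
  have "(\<Sum>a\<in>{k..<n}. f a * C a) \<le> (\<Sum>a\<in>{k..<n}. h * C a)"
    using fle C0 by (intro sum_mono mult_right_mono) auto
  hence 2: "(\<Sum>a\<in>{k..<n}. f a * C a) \<le> h * (real k - (\<Sum>a<k. C a))"
    by (simp add: sum_distrib_left[symmetric] tot)
  show ?thesis using 1 2 unfolding eq by (simp add: C_def left_diff_distrib)
qed

section \<open>Diagonals of projections and leverage scores\<close>

text \<open>Here \<open>x\<close> and \<open>y\<close> are the entries of two matrices with
  \<open>k\<close> orthonormal columns, and \<open>t\<close> is the trace of the product of the
  projections \<open>P\<close> and \<open>Q\<close> onto their column spaces.\<close>

lemma sum_projection_diag_diff:
  fixes x y :: "nat \<Rightarrow> nat \<Rightarrow> real" and k n :: nat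
  defines "t \<equiv> (\<Sum>a<k. \<Sum>b<k. (\<Sum>i<n. x i a * y i b)\<^sup>2)"
  assumes x: "\<And>a b. a < k \<Longrightarrow> b < k \<Longrightarrow> (\<Sum>i<n. x i a * x i b) = (if a = b then 1 else 0)"
    and y: "\<And>a b. a < k \<Longrightarrow> b < k \<Longrightarrow> (\<Sum>i<n. y i a * y i b) = (if a = b then 1 else 0)"
  shows "(\<Sum>i<n. \<bar>(\<Sum>a<k. (x i a)\<^sup>2) - (\<Sum>a<k. (y i a)\<^sup>2)\<bar>) \<le> 2 * sqrt ((real k)\<^sup>2 - t\<^sup>2)"
proof -
  define P where "P i j = (\<Sum>a<k. x i a * x j a)" for i j
  define Q where "Q i j = (\<Sum>a<k. y i a * y j a)" for i j
  have prod: "(\<Sum>j<n. (\<Sum>a<k. u i a * u j a) * (\<Sum>b<k. v i b * v j b))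
      = (\<Sum>a<k. \<Sum>b<k. u i a * v i b * (\<Sum>j<n. u j a * v j b))"
    for u v :: "nat \<Rightarrow> nat \<Rightarrow> real" and i
  proof -
    have "(\<Sum>j<n. (\<Sum>a<k. u i a * u j a) * (\<Sum>b<k. v i b * v j b))
        = (\<Sum>j<n. \<Sum>a<k. \<Sum>b<k. u i a * v i b * (u j a * v j b))"
      by (simp add: sum_product algebra_simps)
    also have "\<dots> = (\<Sum>a<k. \<Sum>j<n. \<Sum>b<k. u i a * v i b * (u j a * v j b))"
      by (rule sum.swap)
    also have "\<dots> = (\<Sum>a<k. \<Sum>b<k. \<Sum>j<n. u i a * v i b * (u j a * v j b))"
      by (intro sum.cong refl sum.swap)
    finally show ?thesis by (simp add: sum_distrib_left)
  qed
  \<comment> \<open>Diagonal part of the identity that the square of a projection is the projection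
    itself.\<close>
  have idem: "(\<Sum>j<n. (\<Sum>a<k. u i a * u j a)\<^sup>2) = (\<Sum>a<k. (u i a)\<^sup>2)"
    if "\<And>a b. a < k \<Longrightarrow> b < k \<Longrightarrow> (\<Sum>i<n. u i a * u i b) = (if a = b then 1 else 0)"
    for u :: "nat \<Rightarrow> nat \<Rightarrow> real" and i
  proof -
    have "(\<Sum>j<n. (\<Sum>a<k. u i a * u j a)\<^sup>2)
        = (\<Sum>a<k. \<Sum>b<k. u i a * u i b * (\<Sum>j<n. u j a * u j b))"
      using prod[where u = u and v = u and i = i] by (simp add: power2_eq_square)
    also have "\<dots> = (\<Sum>a<k. \<Sum>b<k. if b = a then u i a * u i a else 0)"
      using that by (intro sum.cong refl) auto
    finally show ?thesis by (simp add: power2_eq_square)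
  qed
  have trace: "(\<Sum>i<n. \<Sum>a<k. (u i a)\<^sup>2) = real k"
    if "\<And>a b. a < k \<Longrightarrow> b < k \<Longrightarrow> (\<Sum>i<n. u i a * u i b) = (if a = b then 1 else 0)"
    for u :: "nat \<Rightarrow> nat \<Rightarrow> real"
    by (subst sum.swap) (simp add: power2_eq_square that)
  have PP: "(\<Sum>j<n. (P i j)\<^sup>2) = (\<Sum>a<k. (x i a)\<^sup>2)" for i unfolding P_def by (rule idem[OF x])
  have QQ: "(\<Sum>j<n. (Q i j)\<^sup>2) = (\<Sum>a<k. (y i a)\<^sup>2)" for i unfolding Q_def by (rule idem[OF y])
  have normP: "(\<Sum>i<n. \<Sum>j<n. (P i j)\<^sup>2) = real k" unfolding PP by (rule trace[OF x])
  have normQ: "(\<Sum>i<n. \<Sum>j<n. (Q i j)\<^sup>2) = real k" unfolding QQ by (rule trace[OF y])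
  have PQ: "(\<Sum>i<n. \<Sum>j<n. P i j * Q i j) = t"
  proof -
    have "(\<Sum>i<n. \<Sum>j<n. P i j * Q i j)
        = (\<Sum>i<n. \<Sum>a<k. \<Sum>b<k. x i a * y i b * (\<Sum>j<n. x j a * y j b))"
      unfolding P_def Q_def prod ..
    also have "\<dots> = (\<Sum>a<k. \<Sum>i<n. \<Sum>b<k. x i a * y i b * (\<Sum>j<n. x j a * y j b))"
      by (rule sum.swap)
    also have "\<dots> = (\<Sum>a<k. \<Sum>b<k. \<Sum>i<n. x i a * y i b * (\<Sum>j<n. x j a * y j b))"
      by (intro sum.cong refl sum.swap)
    finally show ?thesis by (simp add: t_def power2_eq_square sum_distrib_right)
  qed
  let ?I = "{..<n} \<times> {..<n}"
  \<comment> \<open>The squared Frobenius norms of \<open>P - Q\<close> and \<open>P + Q\<close>: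
    those of \<open>P\<close> and \<open>Q\<close> are both \<open>k\<close>, and the cross term is
    \<open>2 * t\<close>.\<close>
  have minus: "(\<Sum>p\<in>?I. (case p of (i, j) \<Rightarrow> P i j - Q i j)\<^sup>2) = 2 * (real k - t)"
    and plus: "(\<Sum>p\<in>?I. (case p of (i, j) \<Rightarrow> P i j + Q i j)\<^sup>2) = 2 * (real k + t)"
    using normP normQ PQ
    by (simp_all add: sum.cartesian_product case_prod_beta power2_diff power2_sum
        sum.distrib sum_subtractf mult.assoc sum_distrib_left[symmetric])
  have "(\<Sum>i<n. \<bar>(\<Sum>a<k. (x i a)\<^sup>2) - (\<Sum>a<k. (y i a)\<^sup>2)\<bar>)
      = (\<Sum>i<n. \<bar>\<Sum>j<n. (P i j - Q i j) * (P i j + Q i j)\<bar>)"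
  proof -
    \<comment> \<open>The difference of squares is taken entry by entry, so \<open>P\<close> and
      \<open>Q\<close> need not commute.\<close>
    have "(\<Sum>j<n. (P i j - Q i j) * (P i j + Q i j)) = (\<Sum>j<n. (P i j)\<^sup>2 - (Q i j)\<^sup>2)" for i
      by (simp add: power2_eq_square algebra_simps)
    thus ?thesis by (simp only: sum_subtractf PP QQ)
  qed
  also have "\<dots> \<le> (\<Sum>i<n. \<Sum>j<n. \<bar>P i j - Q i j\<bar> * \<bar>P i j + Q i j\<bar>)"
    by (intro sum_mono order_trans[OF sum_abs]) (simp add: abs_mult)
  also have "\<dots> = (\<Sum>p\<in>?I. \<bar>case p of (i, j) \<Rightarrow> P i j - Q i j\<bar> * \<bar>case p of (i, j) \<Rightarrow> P i j + Q i j\<bar>)"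
    by (simp add: sum.cartesian_product case_prod_beta)
  also have "\<dots> \<le> L2_set (\<lambda>(i, j). P i j - Q i j) ?I * L2_set (\<lambda>(i, j). P i j + Q i j) ?I"
    by (rule L2_set_mult_ineq)
  also have "\<dots> = sqrt (4 * ((real k)\<^sup>2 - t\<^sup>2))"
    unfolding L2_set_def minus plus real_sqrt_mult[symmetric]
    by (simp add: power2_eq_square algebra_simps)
  also have "\<dots> = 2 * sqrt ((real k)\<^sup>2 - t\<^sup>2)" by (simp only: real_sqrt_mult real_sqrt_four)
  finally show ?thesis .
qed

lemma leverage_eq:
  assumes "U \<in> carrier_mat n n" "k \<le> n" "i < n"
  shows "leverage U k i = (\<Sum>a<k. (U $$ (i, a))\<^sup>2)"
proof -
  let ?w = "transpose_mat (first_cols U k) *\<^sub>v unit_vec (dim_row U) i"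
  have F: "first_cols U k \<in> carrier_mat n k" using assms unfolding first_cols_def by (intro carrier_matI) auto
  have "?w $ a = U $$ (i, a)" if "a < k" for a
  proof -
    have "?w $ a = col (first_cols U k) a \<bullet> unit_vec n i" using F assms that by simp
    also have "\<dots> = first_cols U k $$ (i, a)"
      using F assms that by (simp add: scalar_prod_right_unit)
    also have "\<dots> = U $$ (i, a)"
      using assms that by (simp add: first_cols_def mat_of_cols_index)
    finally show ?thesis .
  qed
  moreover have "leverage U k i = (\<Sum>a<k. ?w $ a * ?w $ a)"
    unfolding leverage_def vec_norm2_power2 scalar_prod_def[of ?w ?w]
    using F by (simp add: lessThan_atLeast0)
  ultimately show ?thesis by (simp add: power2_eq_square)
qed

section \<open>From the spectral gap to the leverage scores\<close>

theorem lemma8: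
  fixes n d l k :: nat
    and A At U S V Ut St Vt :: "real mat"
    and \<Delta> \<epsilon> \<mu> :: real
  assumes "A \<in> carrier_mat n d"
    and "is_svd A U S V"
    and "sing_val S d > 0"
    and "1 \<le> k" and "k < d"
    and "\<Delta> > 0"
    and "(sing_val S k)\<^sup>2 - (sing_val S (k + 1))\<^sup>2 \<ge> \<Delta> * (sing_val S 1)\<^sup>2"
    and "0 < \<epsilon>" and "\<epsilon> < 1"
    and "At \<in> carrier_mat n l"
    and "is_svd At Ut St Vt"
    and "\<mu> = \<epsilon>\<^sup>2 * \<Delta> / 16"
    and "op_norm (A * transpose_mat A - At * transpose_mat At) \<le> \<mu> * (sing_val S 1)\<^sup>2"
  shows "(\<Sum>i<n. \<bar>leverage U k i - leverage Ut k i\<bar>) \<le> \<epsilon> * (\<Sum>i<n. leverage U k i)"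
proof -
  have oU: "orthonormal_mat n U" and S: "S \<in> carrier_mat n d"
    using assms(1,2) by (simp_all add: is_svd_def)
  have oUt: "orthonormal_mat n Ut"
    using assms(10,11) by (simp add: is_svd_def)
  have U: "U \<in> carrier_mat n n" and Ut: "Ut \<in> carrier_mat n n"
    using oU oUt by (simp_all add: orthonormal_mat_def)
  \<comment> \<open>Past the diagonal \<open>sing_val\<close> is 0, so positivity at
    \<open>d\<close> forces a diagonal of length at least \<open>d\<close>.\<close>
  have "d \<le> n" using assms(3) S by (auto simp: sing_val_def split: if_splits)
  hence kn: "k < n" using assms(5) by simp
  have "0 < (sing_val S d)\<^sup>2" using assms(3) by simp
  also have "\<dots> \<le> (sing_val S 1)\<^sup>2"
    using assms(4,5) by (intro is_svd_sing_val_antimono[OF assms(2)]) auto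
  finally have s1: "0 < (sing_val S 1)\<^sup>2" .

  \<comment> \<open>The columns of \<open>U\<close> and \<open>Ut\<close> are orthonormal bases, so
    \<open>c\<close> is doubly stochastic. The values \<open>f\<close> and \<open>ft\<close> are the
    eigenvalues of the two Gram matrices, numbered from 0: \<open>f (k - 1)\<close> and
    \<open>f k\<close> are the two sides of the gap.\<close>
  define c where "c a b = (col U a \<bullet> col Ut b)\<^sup>2" for a b
  define f where "f a = (sing_val S (a + 1))\<^sup>2" for a
  define ft where "ft a = (sing_val St (a + 1))\<^sup>2" for a
  define t where "t = (\<Sum>a<k. \<Sum>b<k. c a b)"
  let ?E = "A * transpose_mat A - At * transpose_mat At"
  have colU: "col U a \<in> carrier_vec n" and colUt: "col Ut a \<in> carrier_vec n" for a
    using U Ut by (auto intro: carrier_vecI)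
  have c_comm: "c a b = (col Ut b \<bullet> col U a)\<^sup>2" for a b
    by (simp only: c_def comm_scalar_prod[OF colU[of a] colUt[of b]])
  have c0: "0 \<le> c a b" for a b by (simp add: c_def)
  have ccol: "(\<Sum>a<n. c a b) = 1" if "b < n" for b
    by (simp add: c_def orthonormal_mat_parseval[OF oU colUt] orthonormal_mat_col[OF oUt that that])
  have crow: "(\<Sum>b<n. c a b) = 1" if "a < n" for a
    by (simp add: c_comm orthonormal_mat_parseval[OF oUt colU] orthonormal_mat_col[OF oU that that])
  have k0: "f (k - 1) = (sing_val S k)\<^sup>2" using assms(4) by (simp add: f_def)

  have t0: "0 \<le> t" unfolding t_def using c0 by (intro sum_nonneg)
  have "t \<le> (\<Sum>a<k. \<Sum>b<n. c a b)"
    unfolding t_def using kn c0 by (intro sum_mono sum_mono2) auto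
  also have "\<dots> = real k" using kn crow by simp
  finally have tk: "t \<le> real k" .

  have gap: "(f (k - 1) - f k) * (real k - t) \<le> (\<Sum>a<k. f a) - (\<Sum>b<k. \<Sum>a<n. f a * c a b)"
    unfolding t_def
    by (rule doubly_stochastic_gap[where c = c and n = n and k = k, OF kn c0 ccol crow])
      (auto simp: f_def intro!: is_svd_sing_val_antimono[OF assms(2)])
  have t_swap: "t = (\<Sum>b<k. \<Sum>a<k. c a b)" unfolding t_def by (rule sum.swap)
  \<comment> \<open>The same inequality with the two bases exchanged. For \<open>At\<close> only the
    sign of the gap matters, which turns it into Ky Fan's principle.\<close>
  have "(ft (k - 1) - ft k) * (real k - t) \<le> (\<Sum>b<k. ft b) - (\<Sum>a<k. \<Sum>b<n. ft b * c a b)"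
    unfolding t_swap
    by (rule doubly_stochastic_gap[where c = "\<lambda>b a. c a b" and n = n and k = k, OF kn c0 crow ccol])
      (auto simp: ft_def intro!: is_svd_sing_val_antimono[OF assms(11)])
  moreover have "0 \<le> (ft (k - 1) - ft k) * (real k - t)"
    using is_svd_sing_val_antimono[OF assms(11), of k "k + 1"] assms(4) tk by (simp add: ft_def)
  ultimately have ky_fan: "(\<Sum>a<k. \<Sum>b<n. ft b * c a b) \<le> (\<Sum>b<k. ft b)" by linarith

  have E: "?E \<in> carrier_mat n n" using assms(1,10) by auto
  have Eform: "v \<bullet> (?E *\<^sub>v v) = (\<Sum>a<n. f a * (col U a \<bullet> v)\<^sup>2) - (\<Sum>b<n. ft b * (col Ut b \<bullet> v)\<^sup>2)"
    if v: "v \<in> carrier_vec n" for v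
  proof -
    have M: "A * transpose_mat A \<in> carrier_mat n n" "At * transpose_mat At \<in> carrier_mat n n"
      using assms(1,10) by auto
    have "v \<bullet> (?E *\<^sub>v v) = v \<bullet> ((A * transpose_mat A) *\<^sub>v v) - v \<bullet> ((At * transpose_mat At) *\<^sub>v v)"
      using M v by (simp only: minus_mult_distrib_mat_vec[OF M v] scalar_prod_minus_distrib[OF v
            mult_mat_vec_carrier[OF M(1) v] mult_mat_vec_carrier[OF M(2) v]])
    thus ?thesis
      using is_svd_quadratic_form[OF assms(2,1) v] is_svd_quadratic_form[OF assms(11,10) v]
      by (simp add: f_def ft_def)
  qed
  \<comment> \<open>Testing \<open>?E\<close> on a column of \<open>U\<close> leaves one eigenvalue
    of the first Gram matrix by orthonormality. \<open>EUt\<close> does this for \<open>Ut\<close>;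
    summing each over \<open>k\<close> columns gives the traces of \<open>?E\<close> against
    \<open>P\<close> and \<open>Q\<close>.\<close>
  have EU: "f a - (\<Sum>b<n. ft b * c a b) \<le> \<mu> * (sing_val S 1)\<^sup>2" if a: "a < n" for a
  proof -
    have "(\<Sum>a'<n. f a' * (col U a' \<bullet> col U a)\<^sup>2) = (\<Sum>a'<n. if a' = a then f a else 0)"
      using orthonormal_mat_col[OF oU] a by (intro sum.cong) auto
    hence "col U a \<bullet> (?E *\<^sub>v col U a) = f a - (\<Sum>b<n. ft b * c a b)"
      using a by (simp add: Eform[OF colU] c_comm)
    moreover have "\<bar>col U a \<bullet> (?E *\<^sub>v col U a)\<bar> \<le> op_norm ?E"
      using orthonormal_mat_col[OF oU a a] by (intro quadratic_form_le_op_norm[OF E colU]) simp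
    ultimately show ?thesis using assms(13) by linarith
  qed
  have EUt: "(\<Sum>a<n. f a * c a b) - ft b \<ge> - (\<mu> * (sing_val S 1)\<^sup>2)" if b: "b < n" for b
  proof -
    have "(\<Sum>b'<n. ft b' * (col Ut b' \<bullet> col Ut b)\<^sup>2) = (\<Sum>b'<n. if b' = b then ft b else 0)"
      using orthonormal_mat_col[OF oUt] b by (intro sum.cong) auto
    hence "col Ut b \<bullet> (?E *\<^sub>v col Ut b) = (\<Sum>a<n. f a * c a b) - ft b"
      using b by (simp add: Eform[OF colUt] c_def)
    moreover have "\<bar>col Ut b \<bullet> (?E *\<^sub>v col Ut b)\<bar> \<le> op_norm ?E"
      using orthonormal_mat_col[OF oUt b b] by (intro quadratic_form_le_op_norm[OF E colUt]) simp
    ultimately show ?thesis using assms(13) by linarith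
  qed
  have "(\<Sum>a<k. f a - (\<Sum>b<n. ft b * c a b)) \<le> (\<Sum>a<k. \<mu> * (sing_val S 1)\<^sup>2)"
    using EU kn by (intro sum_mono) auto
  moreover have "(\<Sum>b<k. - (\<mu> * (sing_val S 1)\<^sup>2)) \<le> (\<Sum>b<k. (\<Sum>a<n. f a * c a b) - ft b)"
    using EUt kn by (intro sum_mono) auto
  ultimately have "(f (k - 1) - f k) * (real k - t) \<le> 2 * (real k * (\<mu> * (sing_val S 1)\<^sup>2))"
    using gap ky_fan by (simp add: sum_subtractf)
  moreover have "\<Delta> * (sing_val S 1)\<^sup>2 * (real k - t) \<le> (f (k - 1) - f k) * (real k - t)"
    using assms(7) tk k0 by (intro mult_right_mono) (auto simp: f_def)
  \<comment> \<open>Since \<open>\<mu>\<close> is \<open>\<epsilon>\<^sup>2 * \<Delta> / 16\<close>,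
    the bound from the \<open>2 * k\<close> test vectors contains the factor to be cancelled, which
    is positive.\<close>
  ultimately have "(\<Delta> * (sing_val S 1)\<^sup>2) * (real k - t) \<le> (\<Delta> * (sing_val S 1)\<^sup>2) * (real k * \<epsilon>\<^sup>2 / 8)"
    by (simp add: assms(12) algebra_simps)
  hence kt: "real k - t \<le> real k * \<epsilon>\<^sup>2 / 8"
    using s1 assms(6) by (simp only: mult_le_cancel_left_pos mult_pos_pos)

  have sq: "(real k)\<^sup>2 - t\<^sup>2 \<le> (real k * \<epsilon> / 2)\<^sup>2"
  proof -
    have "(real k)\<^sup>2 - t\<^sup>2 = (real k - t) * (real k + t)" by (simp add: power2_eq_square algebra_simps)
    \<comment> \<open>The second factor uses \<open>t \<le> k\<close>.\<close>
    also have "\<dots> \<le> (real k * \<epsilon>\<^sup>2 / 8) * (2 * real k)"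
      using kt tk t0 by (intro mult_mono) auto
    also have "\<dots> = (real k * \<epsilon> / 2)\<^sup>2" by (simp add: power2_eq_square)
    finally show ?thesis .
  qed
  have ip: "col X a \<bullet> col Y b = (\<Sum>i<n. X $$ (i, a) * Y $$ (i, b))"
    if "X \<in> carrier_mat n n" "Y \<in> carrier_mat n n" "a < n" "b < n" for X Y :: "real mat" and a b
    using that by (simp add: scalar_prod_def lessThan_atLeast0)
  have orthU: "(\<Sum>i<n. U $$ (i, a) * U $$ (i, b)) = (if a = b then 1 else 0)" if "a < k" "b < k" for a b
    using that kn orthonormal_mat_col[OF oU, of a b] ip[OF U U, of a b] by simp
  have orthUt: "(\<Sum>i<n. Ut $$ (i, a) * Ut $$ (i, b)) = (if a = b then 1 else 0)" if "a < k" "b < k" for a b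
    using that kn orthonormal_mat_col[OF oUt, of a b] ip[OF Ut Ut, of a b] by simp
  have t_eq: "(\<Sum>a<k. \<Sum>b<k. (\<Sum>i<n. U $$ (i, a) * Ut $$ (i, b))\<^sup>2) = t"
    unfolding t_def c_def using kn by (intro sum.cong refl) (simp add: ip[OF U Ut])
  have levU: "leverage U k i = (\<Sum>a<k. (U $$ (i, a))\<^sup>2)"
    and levUt: "leverage Ut k i = (\<Sum>a<k. (Ut $$ (i, a))\<^sup>2)" if "i < n" for i
    using leverage_eq[OF U _ that] leverage_eq[OF Ut _ that] kn by auto
  \<comment> \<open>The trace of \<open>P\<close> is \<open>k\<close>, so the error relative to the
    total score is an error relative to \<open>k\<close>.\<close>
  have total: "(\<Sum>i<n. leverage U k i) = real k"
  proof -
    have "(\<Sum>i<n. leverage U k i) = (\<Sum>i<n. \<Sum>a<k. (U $$ (i, a))\<^sup>2)" using levU by simp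
    also have "\<dots> = (\<Sum>a<k. \<Sum>i<n. (U $$ (i, a))\<^sup>2)" by (rule sum.swap)
    finally show ?thesis using orthU by (simp add: power2_eq_square)
  qed
  have "(\<Sum>i<n. \<bar>leverage U k i - leverage Ut k i\<bar>) \<le> 2 * sqrt ((real k)\<^sup>2 - t\<^sup>2)"
    using sum_projection_diag_diff[where k = k and n = n and x = "\<lambda>i a. U $$ (i, a)"
        and y = "\<lambda>i a. Ut $$ (i, a)"] orthU orthUt
    by (simp add: levU levUt t_eq)
  also have "\<dots> \<le> 2 * (real k * \<epsilon> / 2)"
    using real_sqrt_le_mono[OF sq] assms(8) by simp
  finally show ?thesis using total by (simp add: mult.commute)
qed

end
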